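(* Let $\Sigma$ be a finite alphabet and let $w,v\in\Sigma^+$. The identity $w=v$ is satisfied in $UT_2(\mathbb{T})$ if and only if the tropical polynomials $f_t^w$ and $f_t^v$ are equivalent for all $t\in\Sigma$.
   Context: The tropical semiring $\mathbb{T}$ is the set $\mathbb{R}\cup\{-\infty\}$ with operations $a\oplus b=\max(a,b)$ and $a\otimes b=a+b$, where $-\infty\oplus a=a$ and $-\infty\otimes a=-\infty$ for all $a\in\mathbb{T}$. $UT_2(\mathbb{T})$ is the monoid of all $2\times 2$ matrices over $\mathbb{T}$ whose entry below the main diagonal is $-\infty$, under the matrix multiplication induced by $\oplus$ and $\otimes$. $\Sigma^+$ is the free semigroup of non-empty words over $\Sigma$. The identity $w=v$ is satisfied in a semigroup $S$ if every semigroup morphism $\Sigma^+\to S$ maps $w$ and $v$ to the same element of $S$. For a word $w$ over $\Sigma$, $|w|$ is its length and $w_i$ its $i$th letter. For $s\in\Sigma$ and $0\le i\le |w|$, $\lambda_s^w(i)$ is the number of occurrences of $s$ within the first $i$ letters of $w$. For $t\in\Sigma$ define the formal tropical polynomial, in variables $x_s$ ($s\in\Sigma$), $$f_t^w=\bigoplus_{1\le i\le |w|,\ w_i=t}\ \bigotimes_{s\in\Sigma} x_s^{\lambda_s^w(i-1)},$$ where sums, products and powers are interpreted tropically (so $x^m$ means $m\cdot x$ classically, and $x^0$ is the constant $0$), and the maximum over an empty set is $-\infty$. Each formal tropical polynomial defines a function $\mathbb{T}^\Sigma\to\mathbb{T}$ by evaluation; two formal polynomials are equivalent if they define the same function. 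*)

theory Defs
  imports
    "HOL-Analysis.Cartesian_Space"
    "HOL-Algebra.Group"
    "HOL-Library.Poly_Mapping"
begin

text \<open>
  The tropical semiring. Through the class instance below, the semiring notation is read
  tropically: \<open>0\<close> is minus infinity, \<open>1\<close> is the real number zero, \<open>+\<close> is maximum and \<open>*\<close> is
  addition. Hence sums, products, powers and the matrix product over \<open>trop\<close> are the tropical
  ones; in particular an empty sum is \<open>MInf\<close> and \<open>x ^ 0 = Fin 0\<close> for every \<open>x\<close>, also for \<open>MInf\<close>.
\<close>

datatype trop = MInf | Fin real

instantiation trop :: comm_semiring_1
begin

definition zero_trop :: trop where
  "0 = MInf"

definition one_trop :: trop where
  "1 = Fin 0"

fun plus_trop :: "trop \<Rightarrow> trop \<Rightarrow> trop" where
  "MInf + b = b"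
| "a + MInf = a"
| "Fin x + Fin y = Fin (max x y)"

fun times_trop :: "trop \<Rightarrow> trop \<Rightarrow> trop" where
  "MInf * b = MInf"
| "a * MInf = MInf"
| "Fin x * Fin y = Fin (x + y)"

instance
proof
  fix a b c :: trop
  show "a + b + c = a + (b + c)"
    by (cases a; cases b; cases c) (auto simp: max.assoc)
  show "a + b = b + a"
    by (cases a; cases b) (auto simp: max.commute)
  show "0 + a = a"
    by (simp add: zero_trop_def)
  show "a * b * c = a * (b * c)"
    by (cases a; cases b; cases c) auto
  show "a * b = b * a"
    by (cases a; cases b) auto
  show "1 * a = a"
    by (cases a) (auto simp: one_trop_def)
  show "(a + b) * c = a * c + b * c"
    by (cases a; cases b; cases c) (auto simp: max_add_distrib_left)
  show "0 * a = 0"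
    by (simp add: zero_trop_def)
  show "a * 0 = 0"
    by (cases a) (simp_all add: zero_trop_def)
  show "(0::trop) \<noteq> 1"
    by (simp add: zero_trop_def one_trop_def)
qed

end

definition UT2 :: "(trop ^ 2 ^ 2) monoid" where
  "UT2 = \<lparr>carrier = {A. A $ 2 $ 1 = MInf}, mult = (**), one = mat 1\<rparr>"

lemma monoid_UT2: "monoid UT2"
proof (rule monoidI)
  show "A \<otimes>\<^bsub>UT2\<^esub> B \<in> carrier UT2" if "A \<in> carrier UT2" "B \<in> carrier UT2" for A B
    using that
    by (simp add: UT2_def matrix_matrix_mult_def sum_2 zero_trop_def[symmetric])
qed (simp_all add: UT2_def matrix_mul_assoc, simp add: mat_def zero_trop_def)

text \<open>
  The free semigroup of non-empty words. It is presented as a \<open>monoid\<close> record so that \<open>hom\<close>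
  applies; \<open>hom\<close> only refers to the carrier and the multiplication. The field \<open>one\<close>
  is irrelevant and lies outside the carrier.
\<close>

definition free_semigroup :: "'a list monoid" where
  "free_semigroup = \<lparr>carrier = {w. w \<noteq> []}, mult = (@), one = []\<rparr>"

definition satisfies_identity :: "('b, 'c) monoid_scheme \<Rightarrow> 'a list \<Rightarrow> 'a list \<Rightarrow> bool" where
  "satisfies_identity S w v \<longleftrightarrow> (\<forall>\<phi> \<in> hom free_semigroup S. \<phi> w = \<phi> v)"

text \<open>
  Formal tropical polynomials in the variables indexed by \<open>'a\<close>: finitely supported maps from
  exponent vectors to coefficients, with the convolution product of \<open>Poly_Mapping\<close>.
\<close>

type_synonym 'a trop_poly = "('a \<Rightarrow>\<^sub>0 nat) \<Rightarrow>\<^sub>0 trop"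

definition trop_var :: "'a \<Rightarrow> 'a trop_poly" where
  "trop_var s = Poly_Mapping.single (Poly_Mapping.single s 1) 1"

definition trop_eval :: "'a::finite trop_poly \<Rightarrow> ('a \<Rightarrow> trop) \<Rightarrow> trop" where
  "trop_eval p x = (\<Sum>m \<in> Poly_Mapping.keys p.
     Poly_Mapping.lookup p m * (\<Prod>s\<in>UNIV. x s ^ Poly_Mapping.lookup m s))"

definition trop_equiv :: "'a::finite trop_poly \<Rightarrow> 'a trop_poly \<Rightarrow> bool" where
  "trop_equiv p q \<longleftrightarrow> trop_eval p = trop_eval q"

definition letter_count :: "'a list \<Rightarrow> 'a \<Rightarrow> nat \<Rightarrow> nat" where
  "letter_count w s i = count_list (take i w) s"

text \<open>List positions start at 0, so the \<open>i\<close>th letter of \<open>w\<close> is \<open>w ! (i - 1)\<close>.\<close>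

definition word_poly :: "'a::finite \<Rightarrow> 'a list \<Rightarrow> 'a trop_poly" where
  "word_poly t w = (\<Sum>i | 1 \<le> i \<and> i \<le> length w \<and> w ! (i - 1) = t.
     \<Prod>s\<in>UNIV. trop_var s ^ letter_count w s (i - 1))"

end

theory Submission
  imports Defs
begin

text \<open>
  Let the letter \<open>s\<close> be sent to the upper triangular matrix with diagonal \<open>a s\<close>, \<open>c s\<close> and
  corner \<open>b s\<close>. If all \<open>c s\<close> are finite, then the corner of the image of \<open>w\<close> is the product of
  the \<open>c s\<close> over the letters of \<open>w\<close>, times the sum over \<open>t\<close> of \<open>b t / c t\<close> times the value of
  \<open>f\<^sub>t\<^sup>w\<close> at \<open>a / c\<close>. Evaluating \<open>f\<^sub>t\<^sup>w\<close> at \<open>x\<^sub>t = Fin 1\<close> and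
  \<open>x\<^sub>s = Fin 0\<close> for the other \<open>s\<close> recovers the number of occurrences of \<open>t\<close> in \<open>w\<close>, so the
  polynomials determine the images under
  all such morphisms; infinite \<open>c s\<close> follow by continuity. Conversely, \<open>f\<^sub>t\<^sup>w\<close> is itself a corner
  entry: take \<open>a = x\<close>, \<open>c = Fin 0\<close>, and let \<open>b\<close> be \<open>Fin 0\<close> at \<open>t\<close> and
  \<open>MInf\<close> elsewhere.
\<close>

section \<open>Upper triangular images of words\<close>

text \<open>Follows the upper right entry of a product of triangular matrices letter by letter; the
  empty word gives the identity matrix, hence corner \<open>0\<close>.\<close>

fun corner :: "('a \<Rightarrow> 'b::comm_semiring_1) \<Rightarrow> ('a \<Rightarrow> 'b) \<Rightarrow> ('a \<Rightarrow> 'b) \<Rightarrow> 'a list \<Rightarrow> 'b" where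
  "corner a b c [] = 0"
| "corner a b c (s # w) = a s * corner a b c w + b s * prod_list (map c w)"

definition tri_mat :: "'b::comm_semiring_1 \<Rightarrow> 'b \<Rightarrow> 'b \<Rightarrow> 'b ^ 2 ^ 2" where
  "tri_mat a b c = vector [vector [a, b], vector [0, c]]"

lemma tri_mat_nth [simp]:
  "tri_mat a b c $ 1 $ 1 = a" "tri_mat a b c $ 1 $ 2 = b"
  "tri_mat a b c $ 2 $ 1 = 0" "tri_mat a b c $ 2 $ 2 = c"
  by (simp_all add: tri_mat_def)

lemma tri_mat_eq_iff: "tri_mat a b c = tri_mat a' b' c' \<longleftrightarrow> a = a' \<and> b = b' \<and> c = c'"
  by (metis tri_mat_nth)

lemma tri_mat_mult:
  "tri_mat a b c ** tri_mat a' b' c' = tri_mat (a * a') (a * b' + b * c') (c * c')"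
  by (simp add: vec_eq_iff forall_2 matrix_matrix_mult_def sum_2)

definition word_mat ::
  "('a \<Rightarrow> 'b::comm_semiring_1) \<Rightarrow> ('a \<Rightarrow> 'b) \<Rightarrow> ('a \<Rightarrow> 'b) \<Rightarrow> 'a list \<Rightarrow> 'b ^ 2 ^ 2" where
  "word_mat a b c w = tri_mat (prod_list (map a w)) (corner a b c w) (prod_list (map c w))"

lemma word_mat_Cons: "word_mat a b c (s # w) = tri_mat (a s) (b s) (c s) ** word_mat a b c w"
  by (simp add: word_mat_def tri_mat_mult)

lemma corner_append:
  "corner a b c (u @ w) = prod_list (map a u) * corner a b c w + corner a b c u * prod_list (map c w)"
  by (induction u) (simp_all add: algebra_simps)

lemma word_mat_append: "word_mat a b c (u @ w) = word_mat a b c u ** word_mat a b c w"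
  by (simp add: word_mat_def tri_mat_mult corner_append)

lemma carrier_UT2_eq: "carrier UT2 = {A. \<exists>a b c. A = tri_mat a b c}"
proof -
  have "A = tri_mat (A $ 1 $ 1) (A $ 1 $ 2) (A $ 2 $ 2)" if "A $ 2 $ 1 = MInf" for A :: "trop ^ 2 ^ 2"
    using that by (simp add: vec_eq_iff forall_2 zero_trop_def)
  then show ?thesis
    by (auto simp: UT2_def zero_trop_def[symmetric])
qed

lemma word_mat_hom: "word_mat a b c \<in> hom free_semigroup UT2"
  by (auto simp: hom_def carrier_UT2_eq free_semigroup_def word_mat_append)
    (auto simp: word_mat_def UT2_def)

text \<open>A morphism is determined by its values on letters. The induction starts at one letter
  because its value at \<open>[]\<close> is unconstrained.\<close>

lemma hom_eq_word_mat:
  assumes "\<phi> \<in> hom free_semigroup UT2" and "w \<noteq> []"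
  shows "\<phi> w = word_mat (\<lambda>s. \<phi> [s] $ 1 $ 1) (\<lambda>s. \<phi> [s] $ 1 $ 2) (\<lambda>s. \<phi> [s] $ 2 $ 2) w"
    (is "_ = ?M w")
  using assms(2)
proof (induction w rule: list_nonempty_induct)
  case (single s)
  have "\<phi> [s] \<in> carrier UT2"
    using assms(1) by (auto simp: hom_def free_semigroup_def)
  then show ?case
    by (auto simp: carrier_UT2_eq word_mat_def)
next
  case (cons s w)
  have "\<phi> [s] \<in> carrier UT2"
    using assms(1) by (auto simp: hom_def free_semigroup_def)
  then have "\<phi> [s] = tri_mat (\<phi> [s] $ 1 $ 1) (\<phi> [s] $ 1 $ 2) (\<phi> [s] $ 2 $ 2)"
    by (auto simp: carrier_UT2_eq)
  moreover have "\<phi> (s # w) = \<phi> [s] ** \<phi> w"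
    using hom_mult[OF assms(1), of "[s]" w] \<open>w \<noteq> []\<close> by (simp add: free_semigroup_def UT2_def)
  ultimately show ?case
    using cons.IH by (metis word_mat_Cons)
qed

lemma satisfies_identity_UT2_iff:
  fixes w v :: "'a list"
  assumes "w \<noteq> []" and "v \<noteq> []"
  shows "satisfies_identity UT2 w v \<longleftrightarrow>
    (\<forall>a b c :: 'a \<Rightarrow> trop. word_mat a b c w = word_mat a b c v)"
proof
  assume "satisfies_identity UT2 w v"
  then show "\<forall>a b c :: 'a \<Rightarrow> trop. word_mat a b c w = word_mat a b c v"
    by (simp add: satisfies_identity_def word_mat_hom)
next
  assume "\<forall>a b c :: 'a \<Rightarrow> trop. word_mat a b c w = word_mat a b c v"
  then show "satisfies_identity UT2 w v"
    by (simp add: satisfies_identity_def hom_eq_word_mat[OF _ assms(1)] hom_eq_word_mat[OF _ assms(2)])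
qed

section \<open>Evaluation of the word polynomials\<close>

text \<open>Lets \<open>p\<close>, \<open>q\<close> and \<open>p + q\<close> be evaluated over a
  common set of exponents; those outside the support have coefficient \<open>0\<close>.\<close>

lemma trop_eval_eq_sum_superset:
  assumes "finite K" and "Poly_Mapping.keys p \<subseteq> K"
  shows "trop_eval p x = (\<Sum>m\<in>K. Poly_Mapping.lookup p m * (\<Prod>s\<in>UNIV. x s ^ Poly_Mapping.lookup m s))"
  unfolding trop_eval_def using assms
  by (intro sum.mono_neutral_left) (auto simp: in_keys_iff)

lemma trop_eval_zero [simp]: "trop_eval 0 x = 0"
  by (simp add: trop_eval_def)

lemma trop_eval_add: "trop_eval (p + q) x = trop_eval p x + trop_eval q x"
proof -
  let ?K = "Poly_Mapping.keys p \<union> Poly_Mapping.keys q"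
  have *: "Poly_Mapping.keys (p + q) \<subseteq> ?K"
    by (rule keys_add)
  show ?thesis
    using trop_eval_eq_sum_superset[of ?K "p + q" x, OF _ *]
      trop_eval_eq_sum_superset[of ?K p x] trop_eval_eq_sum_superset[of ?K q x]
    by (simp add: lookup_add distrib_right sum.distrib)
qed

lemma trop_eval_sum: "trop_eval (\<Sum>i\<in>I. p i) x = (\<Sum>i\<in>I. trop_eval (p i) x)"
  by (induction I rule: infinite_finite_induct) (simp_all add: trop_eval_add)

lemma trop_eval_single_one:
  "trop_eval (Poly_Mapping.single m 1) x = (\<Prod>s\<in>UNIV. x s ^ Poly_Mapping.lookup m s)"
  by (simp add: trop_eval_def)

lemma trop_var_power: "trop_var s ^ k = Poly_Mapping.single (Poly_Mapping.single s k) 1"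
  by (induction k) (simp_all add: trop_var_def mult_single single_add[symmetric])

lemma prod_single_one:
  "(\<Prod>s\<in>A. Poly_Mapping.single (f s) (1 :: 'b::comm_semiring_1)) =
    Poly_Mapping.single (\<Sum>s\<in>A. f s :: 'm::comm_monoid_add) 1"
  by (induction A rule: infinite_finite_induct) (simp_all add: mult_single)

lemma trop_eval_monomial: "trop_eval (\<Prod>s\<in>UNIV. trop_var s ^ k s) x = (\<Prod>s\<in>UNIV. x s ^ k s)"
  by (simp add: trop_var_power prod_single_one trop_eval_single_one lookup_sum lookup_single when_def)

lemma prod_power_count_list:
  fixes x :: "'a::finite \<Rightarrow> 'b::comm_semiring_1"
  shows "(\<Prod>s\<in>UNIV. x s ^ count_list u s) = prod_list (map x u)"
proof (induction u)
  case (Cons r u)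
  have "(\<Prod>s\<in>UNIV. x s ^ count_list (r # u) s) =
      (\<Prod>s\<in>UNIV. (if r = s then x s else 1) * x s ^ count_list u s)"
    by (intro prod.cong) auto
  then show ?case
    using Cons by (simp add: prod.distrib)
qed simp

lemma trop_eval_word_poly_sum:
  "trop_eval (word_poly t w) x = (\<Sum>i<length w. if w ! i = t then prod_list (map x (take i w)) else 0)"
proof -
  have "trop_eval (word_poly t w) x =
      (\<Sum>i | 1 \<le> i \<and> i \<le> length w \<and> w ! (i - 1) = t. prod_list (map x (take (i - 1) w)))"
    by (simp add: word_poly_def trop_eval_sum trop_eval_monomial letter_count_def)
      (simp add: prod_power_count_list)
  also have "\<dots> = (\<Sum>i | i < length w \<and> w ! i = t. prod_list (map x (take i w)))"
    by (rule sum.reindex_bij_witness[of _ Suc "\<lambda>i. i - 1"]) auto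
  also have "\<dots> = (\<Sum>i<length w. if w ! i = t then prod_list (map x (take i w)) else 0)"
    by (auto simp: sum.inter_filter[symmetric] intro: sum.cong)
  finally show ?thesis .
qed

lemma trop_eval_word_poly_Nil [simp]: "trop_eval (word_poly t []) x = 0"
  by (simp add: trop_eval_word_poly_sum)

text \<open>The first letter has the empty prefix, whose monomial is \<open>1\<close>, and it lies
  in the prefix of every later position, whence the factor \<open>x s\<close>. This recursion
  matches that of \<open>corner\<close>.\<close>

lemma trop_eval_word_poly_Cons [simp]:
  "trop_eval (word_poly t (s # w)) x = (if s = t then 1 else 0) + x s * trop_eval (word_poly t w) x"
  by (simp add: trop_eval_word_poly_sum sum.lessThan_Suc_shift sum_distrib_left if_distrib[of "(*) _"]
      del: sum.lessThan_Suc cong: if_cong)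

lemma trop_eval_word_poly_eq_corner:
  "trop_eval (word_poly t w) x = corner x (\<lambda>s. if s = t then 1 else 0) (\<lambda>_. 1) w"
  by (induction w) (simp_all add: map_replicate_const add.commute)

lemma corner_one_eq_sum:
  "corner x b (\<lambda>_. 1) w = (\<Sum>t\<in>UNIV. b t * trop_eval (word_poly t w) x)"
  by (induction w)
    (simp_all add: map_replicate_const distrib_left sum.distrib sum_distrib_left ac_simps
      if_distrib[of "(*) _"] cong: if_cong)

text \<open>At this point a monomial counts the earlier occurrences of \<open>t\<close>. The maximum
  is reached at the last occurrence, which does not count itself.\<close>

lemma trop_eval_word_poly_count:
  "trop_eval (word_poly t w) (\<lambda>s. if s = t then Fin 1 else 1) =
    (if count_list w t = 0 then 0 else Fin (real (count_list w t) - 1))"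
  by (induction w) (auto simp: zero_trop_def one_trop_def)

lemma trop_equiv_imp_count_list_eq:
  assumes "trop_equiv (word_poly t w) (word_poly t v)"
  shows "count_list w t = count_list v t"
  using assms trop_eval_word_poly_count[of t w] trop_eval_word_poly_count[of t v]
  by (auto simp: trop_equiv_def zero_trop_def split: if_splits)

section \<open>Passage to matrices with infinite diagonal entries\<close>

text \<open>With \<open>c s\<close> invertible, the matrix of \<open>s\<close> is \<open>c s\<close>
  times one with lower right entry \<open>1\<close>; scalars commute with matrices and collect in
  front.\<close>

lemma corner_scale:
  assumes "\<And>s. c s * d s = 1"
  shows "corner a b c w = prod_list (map c w) * corner (\<lambda>s. a s * d s) (\<lambda>s. b s * d s) (\<lambda>_. 1) w"
proof (induction w)
  case (Cons s w)
  have "c s * prod_list (map c w) * (a s * d s * r + b s * d s) =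
      (c s * d s) * (a s * (prod_list (map c w) * r) + b s * prod_list (map c w))" for r
    by (simp add: algebra_simps)
  then show ?case
    using Cons assms by (simp add: map_replicate_const)
qed simp

text \<open>The exponential turns tropical operations into continuous operations on nonnegative reals.\<close>

fun trop_exp :: "trop \<Rightarrow> real" where
  "trop_exp MInf = 0"
| "trop_exp (Fin x) = exp x"

lemma trop_exp_add: "trop_exp (a + b) = max (trop_exp a) (trop_exp b)"
  by (cases a; cases b) (auto simp: max_def)

lemma trop_exp_mult: "trop_exp (a * b) = trop_exp a * trop_exp b"
  by (cases a; cases b) (auto simp: exp_add)

lemma trop_exp_one [simp]: "trop_exp 1 = 1"
  by (simp add: one_trop_def)

lemma trop_exp_inject: "trop_exp a = trop_exp b \<longleftrightarrow> a = b"
  by (cases a; cases b) auto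

lemma tendsto_trop_exp_prod_list:
  assumes "\<And>s. (\<lambda>n. trop_exp (c n s)) \<longlonglongrightarrow> trop_exp (d s)"
  shows "(\<lambda>n. trop_exp (prod_list (map (c n) w))) \<longlonglongrightarrow> trop_exp (prod_list (map d w))"
  by (induction w) (auto simp: trop_exp_mult intro!: tendsto_mult assms)

lemma tendsto_trop_exp_corner:
  assumes "\<And>s. (\<lambda>n. trop_exp (c n s)) \<longlonglongrightarrow> trop_exp (d s)"
  shows "(\<lambda>n. trop_exp (corner a b (c n) w)) \<longlonglongrightarrow> trop_exp (corner a b d w)"
  by (induction w)
    (auto simp: trop_exp_mult trop_exp_add
      intro!: tendsto_mult tendsto_max tendsto_trop_exp_prod_list assms)

text \<open>Finite elements are dense: \<open>MInf\<close> is the limit of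
  \<open>Fin (- n)\<close>.\<close>

lemma finite_trop_approx: "\<exists>r. (\<lambda>n. trop_exp (Fin (r n))) \<longlonglongrightarrow> trop_exp a"
proof (cases a)
  case MInf
  have "(\<lambda>n. exp (- real n)) \<longlonglongrightarrow> 0"
    by (intro filterlim_compose[OF exp_at_bot] filterlim_compose[OF filterlim_uminus_at_bot_at_top]
        filterlim_real_sequentially)
  then show ?thesis
    using MInf by (intro exI[of _ "\<lambda>n. - real n"]) simp
qed auto

lemma corner_eq:
  fixes w v :: "'a::finite list" and a b c :: "'a \<Rightarrow> trop"
  assumes "\<And>t. trop_equiv (word_poly t w) (word_poly t v)"
    and "\<And>c :: 'a \<Rightarrow> trop. prod_list (map c w) = prod_list (map c v)"
  shows "corner a b c w = corner a b c v"
proof -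
  have fin: "corner a b (\<lambda>s. Fin (r s)) w = corner a b (\<lambda>s. Fin (r s)) v" for r
  proof -
    have "Fin (r s) * Fin (- r s) = 1" for s
      by (simp add: one_trop_def)
    \<comment> \<open>The right side depends on \<open>u\<close> only through data on which
      \<open>w\<close> and \<open>v\<close> agree.\<close>
    then have "corner a b (\<lambda>s. Fin (r s)) u = prod_list (map (\<lambda>s. Fin (r s)) u) *
        (\<Sum>t\<in>UNIV. b t * Fin (- r t) * trop_eval (word_poly t u) (\<lambda>s. a s * Fin (- r s)))" for u
      by (subst corner_scale) (simp_all add: corner_one_eq_sum)
    then show ?thesis
      using assms by (simp add: trop_equiv_def)
  qed
  obtain r where r: "\<And>s. (\<lambda>n. trop_exp (Fin (r s n))) \<longlonglongrightarrow> trop_exp (c s)"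
    using choice[of "\<lambda>s r. (\<lambda>n. trop_exp (Fin (r n))) \<longlonglongrightarrow> trop_exp (c s)"] finite_trop_approx
    by blast
  note lim = tendsto_trop_exp_corner[where c = "\<lambda>n s. Fin (r s n)", OF r]
  \<comment> \<open>By \<open>fin\<close>, both sides are limits of one and the same
    sequence.\<close>
  have "trop_exp (corner a b c w) = trop_exp (corner a b c v)"
    by (rule LIMSEQ_unique[OF lim]) (unfold fin, rule lim)
  then show ?thesis
    by (simp add: trop_exp_inject)
qed

theorem theorem3p3:
  fixes w v :: "'a::finite list"
  assumes "w \<in> carrier free_semigroup" and "v \<in> carrier free_semigroup"
  shows "satisfies_identity UT2 w v \<longleftrightarrow> (\<forall>t. trop_equiv (word_poly t w) (word_poly t v))"
proof -
  have "satisfies_identity UT2 w v \<longleftrightarrow>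
      (\<forall>a b c :: 'a \<Rightarrow> trop. word_mat a b c w = word_mat a b c v)"
    using assms by (intro satisfies_identity_UT2_iff) (simp_all add: free_semigroup_def)
  also have "\<dots> \<longleftrightarrow> (\<forall>t. trop_equiv (word_poly t w) (word_poly t v))"
  proof
    assume "\<forall>a b c :: 'a \<Rightarrow> trop. word_mat a b c w = word_mat a b c v"
    then show "\<forall>t. trop_equiv (word_poly t w) (word_poly t v)"
      by (simp add: word_mat_def tri_mat_eq_iff trop_equiv_def fun_eq_iff trop_eval_word_poly_eq_corner)
  next
    assume equiv: "\<forall>t. trop_equiv (word_poly t w) (word_poly t v)"
    then have "prod_list (map c w) = prod_list (map c v)" for c :: "'a \<Rightarrow> trop"
      \<comment> \<open>Equal letter counts give equal products for every \<open>c\<close>, which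
        settles both diagonal entries.\<close>
      using trop_equiv_imp_count_list_eq by (metis (no_types, lifting) prod.cong prod_power_count_list)
    moreover from this have "corner a b c w = corner a b c v" for a b c :: "'a \<Rightarrow> trop"
      using equiv by (intro corner_eq) auto
    ultimately show "\<forall>a b c :: 'a \<Rightarrow> trop. word_mat a b c w = word_mat a b c v"
      by (simp add: word_mat_def)
  qed
  finally show ?thesis .
qed

end
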